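(* Let $T\subseteq\omega^{<\omega_1}$ be a normal, $\omega$-splitting $\ell_\infty$-tree. Then $G(\mathcal F^\infty_T)$ is a non-metrizable topological group which is an increasing union of metrizable groups (i.e. the union of a chain, increasing under inclusion, of subgroups each metrizable in the induced topology). In particular, $G(\mathcal F^\infty_T)$ is an $(\alpha_1)$-group.
   Context: $\omega^{<\omega_1}$ is the set of functions from countable ordinals to $\omega$. Consider $T\subseteq\omega^{<\omega_1}$ ordered by strict end-extension $\subsetneq$ and closed under restrictions to smaller ordinals, so $T$ is a tree in which the height of $t$ is $\mathrm{ht}(t)=\mathrm{dom}(t)$; $T_\alpha$ is the set of nodes of height $\alpha$ and $T\restriction\delta=\bigcup_{\gamma<\delta}T_\gamma$. $T$ is an $\omega_1$-tree if it has height $\omega_1$ and all levels are countable; it is normal if whenever $s\in T$ and $\mathrm{ht}(s)<\alpha<\omega_1$ there is $t\in T_\alpha$ with $s\subsetneq t$; it is $\omega$-splitting if every node has infinitely many immediate successors. For $f,g\in\omega^{<\omega_1}$ let $\|f\|_\infty=\sup\{f(\gamma):\gamma\in\mathrm{dom}(f)\}$, and let $f-g$ be the function with domain $\mathrm{dom}(f)\cap\mathrm{dom}(g)$ and $(f-g)(\gamma)=|f(\gamma)-g(\gamma)|$. An $\omega_1$-tree $T\subseteq\omega^{<\omega_1}$ is an $\ell_\infty$-tree if $\|s-t\|_\infty<\omega$ for all $s,t\in T$. For $t\in T$ and $n<\omega$ let $F^\infty_n(t)=\{s\in T\restriction\mathrm{ht}(t):\|s-t\|_\infty\le n\}$ and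 $U^\infty_n(t)=\{a\in[T]^{<\omega}:a\cap F^\infty_n(t)=\emptyset\}$. $G(\mathcal F^\infty_T)$ is the group $([T]^{<\omega},\triangle)$ of finite subsets of $T$ with symmetric difference, with the group topology for which $\{U^\infty_n(t):n<\omega,t\in T\}$ is an open neighborhood base at the identity $\emptyset$. A topological group $G$ with identity $e$ is an $(\alpha_1)$-group if for any countable collection $\{s_n:n<\omega\}$ of sequences in $G$ with $\lim s_n=e$ for each $n$, there is a sequence $s$ in $G$ with $\lim s=e$ such that $s_n\setminus s$ is finite for all $n<\omega$ (sequences identified with their ranges). *)

theory Defs
  imports "HOL-Analysis.Analysis" "HOL-Algebra.Coset" "HOL-Library.Countable_Set_Type"
begin

section \<open>Countable ordinals\<close>

text \<open>The elements of this type are the ordinals below \<open>\<omega>\<^sub>1\<close>: up to isomorphism it is the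
  only uncountable well-order with countable initial segments (proved below).\<close>

typedef omega1 = "Field (cardSuc natLeq)"
  using Field_cardSuc_not_empty[OF natLeq_Card_order] by blast

instantiation omega1 :: wellorder
begin

definition less_eq_omega1 :: "omega1 \<Rightarrow> omega1 \<Rightarrow> bool" where
  "a \<le> b \<longleftrightarrow> (Rep_omega1 a, Rep_omega1 b) \<in> cardSuc natLeq"

definition less_omega1 :: "omega1 \<Rightarrow> omega1 \<Rightarrow> bool" where
  "(a :: omega1) < b \<longleftrightarrow> a \<le> b \<and> a \<noteq> b"

instance
proof -
  have wo: "Well_order (cardSuc natLeq)"
    by (rule cardSuc_Well_order[OF natLeq_Card_order])
  have refl: "Refl (cardSuc natLeq)" and tr: "trans (cardSuc natLeq)"
    and anti: "antisym (cardSuc natLeq)" and tot: "Total (cardSuc natLeq)"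
    and wf: "wf (cardSuc natLeq - Id)"
    using wo by (auto simp: order_on_defs)
  have total: "a \<le> b \<or> b \<le> a" for a b :: omega1
    using tot refl Rep_omega1[of a] Rep_omega1[of b]
    by (cases "Rep_omega1 a = Rep_omega1 b") (auto simp: less_eq_omega1_def total_on_def dest: refl_onD)
  have antis: "a \<le> b \<Longrightarrow> b \<le> a \<Longrightarrow> a = b" for a b :: omega1
    using anti unfolding less_eq_omega1_def antisym_def by (metis Rep_omega1_inject)
  have wf': "wf {(a, b :: omega1). a < b}"
  proof -
    have "{(a, b :: omega1). a < b} \<subseteq> inv_image (cardSuc natLeq - Id) Rep_omega1"
      by (auto simp: less_omega1_def less_eq_omega1_def Rep_omega1_inject)
    thus ?thesis using wf wf_inv_image wf_subset by blast
  qed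
  show "OFCLASS(omega1, wellorder_class)"
  proof
    fix x y z :: omega1
    show "x < y \<longleftrightarrow> x \<le> y \<and> \<not> y \<le> x"
      using antis total by (auto simp: less_omega1_def)
    show "x \<le> x" using total[of x x] by simp
    show "x \<le> y \<Longrightarrow> y \<le> z \<Longrightarrow> x \<le> z"
      using tr unfolding less_eq_omega1_def trans_def by blast
    show "x \<le> y \<Longrightarrow> y \<le> x \<Longrightarrow> x = y" by (rule antis)
    show "x \<le> y \<or> y \<le> x" by (rule total)
  next
    fix P :: "omega1 \<Rightarrow> bool" and a
    assume step: "\<And>x. (\<And>y. y < x \<Longrightarrow> P y) \<Longrightarrow> P x"
    show "P a"
      by (rule wf_induct_rule[OF wf']) (use step in auto)
  qed
qed

end

lemma countable_lessThan_omega1: "countable {..<a :: omega1}"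
proof -
  let ?r = "cardSuc natLeq"
  have "(card_of (underS ?r (Rep_omega1 a)), ?r) \<in> ordLess"
    by (rule card_of_underS[OF cardSuc_Card_order[OF natLeq_Card_order] Rep_omega1])
  hence "(card_of (underS ?r (Rep_omega1 a)), natLeq) \<in> ordLeq"
    by (rule iffD1[OF cardSuc_ordLeq_ordLess[OF natLeq_Card_order card_of_Card_order]])
  hence "countable (underS ?r (Rep_omega1 a))"
    by (simp add: countable_card_le_natLeq)
  moreover have "Rep_omega1 ` {..<a} \<subseteq> underS ?r (Rep_omega1 a)"
    by (auto simp: underS_def less_omega1_def less_eq_omega1_def Rep_omega1_inject)
  ultimately have "countable (Rep_omega1 ` {..<a})"
    using countable_subset by blast
  thus ?thesis
    by (rule countable_image_inj_on) (simp add: inj_on_def Rep_omega1_inject)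
qed

lemma uncountable_omega1: "uncountable (UNIV :: omega1 set)"
proof
  assume "countable (UNIV :: omega1 set)"
  hence "countable (Field (cardSuc natLeq))"
    using countable_image[of UNIV Rep_omega1] type_definition.Rep_range[OF type_definition_omega1] by simp
  hence "(card_of (Field (cardSuc natLeq)), natLeq) \<in> ordLeq"
    by (simp add: countable_card_le_natLeq)
  hence "(cardSuc natLeq, natLeq) \<in> ordLeq"
    using card_of_Field_ordIso[OF cardSuc_Card_order[OF natLeq_Card_order]]
      ordIso_ordLeq_trans ordIso_symmetric by blast
  thus False
    using cardSuc_greater[OF natLeq_Card_order] not_ordLess_ordLeq by blast
qed

section \<open>Trees of countable sequences of natural numbers\<close>

type_synonym seq = "omega1 \<rightharpoonup> nat"

text \<open>A sequence indexed by a countable ordinal is a partial function whose domain is an initial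
  segment: an ordinal is identified with the set of its predecessors.\<close>

definition seqs :: "seq set" where
  "seqs = {f. \<exists>\<alpha>. dom f = {..<\<alpha>}}"

definition ht :: "seq \<Rightarrow> omega1" where
  "ht f = (THE \<alpha>. dom f = {..<\<alpha>})"

definition strict_ext :: "seq \<Rightarrow> seq \<Rightarrow> bool" where
  "strict_ext s t \<longleftrightarrow> s \<subseteq>\<^sub>m t \<and> s \<noteq> t"

definition level :: "seq set \<Rightarrow> omega1 \<Rightarrow> seq set" where
  "level T \<alpha> = {t \<in> T. ht t = \<alpha>}"

definition below :: "seq set \<Rightarrow> omega1 \<Rightarrow> seq set" where
  "below T \<delta> = (\<Union>\<gamma><\<delta>. level T \<gamma>)"

definition seq_tree :: "seq set \<Rightarrow> bool" where
  "seq_tree T \<longleftrightarrow> T \<subseteq> seqs \<and> (\<forall>t\<in>T. \<forall>\<alpha>. t |` {..<\<alpha>} \<in> T)"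

text \<open>The height of a tree is the least \<open>\<alpha>\<close> whose level is empty, so a tree of countable
  sequences has height \<open>\<omega>\<^sub>1\<close> iff all levels are nonempty.\<close>

definition omega1_tree :: "seq set \<Rightarrow> bool" where
  "omega1_tree T \<longleftrightarrow> seq_tree T \<and> (\<forall>\<alpha>. level T \<alpha> \<noteq> {} \<and> countable (level T \<alpha>))"

definition normal_tree :: "seq set \<Rightarrow> bool" where
  "normal_tree T \<longleftrightarrow> (\<forall>s\<in>T. \<forall>\<alpha>. ht s < \<alpha> \<longrightarrow> (\<exists>t\<in>level T \<alpha>. strict_ext s t))"

definition immediate_succs :: "seq set \<Rightarrow> seq \<Rightarrow> seq set" where
  "immediate_succs T s =
    {t \<in> T. strict_ext s t \<and> \<not> (\<exists>u\<in>T. strict_ext s u \<and> strict_ext u t)}"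

definition omega_splitting :: "seq set \<Rightarrow> bool" where
  "omega_splitting T \<longleftrightarrow> (\<forall>s\<in>T. infinite (immediate_succs T s))"

definition norm_inf :: "seq \<Rightarrow> enat" where
  "norm_inf f = (SUP \<gamma>\<in>dom f. enat (the (f \<gamma>)))"

definition seq_diff :: "seq \<Rightarrow> seq \<Rightarrow> seq" where
  "seq_diff f g = (\<lambda>\<gamma>. if \<gamma> \<in> dom f \<inter> dom g
     then Some (nat \<bar>int (the (f \<gamma>)) - int (the (g \<gamma>))\<bar>) else None)"

definition linf_tree :: "seq set \<Rightarrow> bool" where
  "linf_tree T \<longleftrightarrow> omega1_tree T \<and> (\<forall>s\<in>T. \<forall>t\<in>T. norm_inf (seq_diff s t) < \<infinity>)"

section \<open>Topological groups\<close>

definition topological_group :: "('a, 'b) monoid_scheme \<Rightarrow> 'a topology \<Rightarrow> bool" where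
  "topological_group G X \<longleftrightarrow> group G \<and> topspace X = carrier G \<and>
     continuous_map (prod_topology X X) X (\<lambda>(x, y). x \<otimes>\<^bsub>G\<^esub> y) \<and>
     continuous_map X X (\<lambda>x. inv\<^bsub>G\<^esub> x)"

definition alpha1_group :: "('a, 'b) monoid_scheme \<Rightarrow> 'a topology \<Rightarrow> bool" where
  "alpha1_group G X \<longleftrightarrow> topological_group G X \<and>
     (\<forall>s :: nat \<Rightarrow> nat \<Rightarrow> 'a.
        (\<forall>n. range (s n) \<subseteq> carrier G \<and> limitin X (s n) \<one>\<^bsub>G\<^esub> sequentially) \<longrightarrow>
        (\<exists>s' :: nat \<Rightarrow> 'a. range s' \<subseteq> carrier G \<and> limitin X s' \<one>\<^bsub>G\<^esub> sequentially \<and>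
           (\<forall>n. finite (range (s n) - range s'))))"

text \<open>A set is open iff around each of its points it contains a translate of a member of \<open>B\<close>.
  This is the only candidate for a group topology in which \<open>B\<close> is a neighbourhood base
  at the identity.\<close>

definition nbhd_base_topology :: "('a, 'b) monoid_scheme \<Rightarrow> 'a set set \<Rightarrow> 'a topology" where
  "nbhd_base_topology G B =
     topology (\<lambda>W. W \<subseteq> carrier G \<and> (\<forall>a\<in>W. \<exists>V\<in>B. a <#\<^bsub>G\<^esub> V \<subseteq> W))"

section \<open>The group associated with a tree\<close>

definition F_inf :: "seq set \<Rightarrow> nat \<Rightarrow> seq \<Rightarrow> seq set" where
  "F_inf T n t = {s \<in> below T (ht t). norm_inf (seq_diff s t) \<le> enat n}"

definition U_inf :: "seq set \<Rightarrow> nat \<Rightarrow> seq \<Rightarrow> seq set set" where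
  "U_inf T n t = {a \<in> Fpow T. a \<inter> F_inf T n t = {}}"

definition G_inf :: "seq set \<Rightarrow> seq set monoid" where
  "G_inf T = \<lparr>carrier = Fpow T, mult = (\<lambda>a b. sym_diff a b), one = {}\<rparr>"

definition G_inf_base :: "seq set \<Rightarrow> seq set set set" where
  "G_inf_base T = {U_inf T n t | n t. t \<in> T}"

definition G_inf_topology :: "seq set \<Rightarrow> seq set topology" where
  "G_inf_topology T = nbhd_base_topology (G_inf T) (G_inf_base T)"

lemma ht_eqI: "dom f = {..<\<alpha>} \<Longrightarrow> ht f = \<alpha>"
  unfolding ht_def by (rule the_equality) auto

lemma dom_eq_lessThan_ht: "f \<in> seqs \<Longrightarrow> dom f = {..<ht f}"
  using ht_eqI by (auto simp: seqs_def)

lemma norm_inf_seq_diff_le: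
  "norm_inf (seq_diff s t) \<le> enat n \<longleftrightarrow>
     (\<forall>\<gamma>\<in>dom s \<inter> dom t. \<bar>int (the (s \<gamma>)) - int (the (t \<gamma>))\<bar> \<le> int n)"
proof -
  have "dom (seq_diff s t) = dom s \<inter> dom t"
    by (auto simp: seq_diff_def dom_def)
  thus ?thesis
    by (auto simp: norm_inf_def SUP_le_iff seq_diff_def nat_le_iff)
qed

lemma F_inf_directed:
  assumes T: "linf_tree T" and s: "s \<in> T" and t: "t \<in> T" and le: "ht s \<le> ht t"
  shows "\<exists>k. F_inf T n s \<union> F_inf T m t \<subseteq> F_inf T k t"
proof -
  from T s t have "norm_inf (seq_diff s t) < \<infinity>" by (simp add: linf_tree_def)
  then obtain d where "norm_inf (seq_diff s t) = enat d" by auto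
  hence d: "\<bar>int (the (s \<gamma>)) - int (the (t \<gamma>))\<bar> \<le> int d" if "\<gamma> \<in> dom s \<inter> dom t" for \<gamma>
    using norm_inf_seq_diff_le[of s t d] that by simp
  have sub: "T \<subseteq> seqs" using T by (simp add: linf_tree_def omega1_tree_def seq_tree_def)
  have dm: "dom v = {..<ht v}" if "v \<in> T" for v using dom_eq_lessThan_ht[of v] that sub by blast
  have "v \<in> F_inf T (m + n + d) t" if v: "v \<in> F_inf T n s" for v
  proof -
    from v have vT: "v \<in> T" "ht v < ht s"
      and vn: "\<forall>\<gamma>\<in>dom v \<inter> dom s. \<bar>int (the (v \<gamma>)) - int (the (s \<gamma>))\<bar> \<le> int n"
      by (auto simp: F_inf_def below_def level_def norm_inf_seq_diff_le)
    have "\<bar>int (the (v \<gamma>)) - int (the (t \<gamma>))\<bar> \<le> int (m + n + d)" if "\<gamma> \<in> dom v \<inter> dom t" for \<gamma>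
    proof -
      have 1: "\<gamma> \<in> dom v \<inter> dom s" and 2: "\<gamma> \<in> dom s \<inter> dom t"
        using that vT(2) unfolding dm[OF vT(1)] dm[OF s] dm[OF t] by auto
      show ?thesis using bspec[OF vn 1] d[OF 2] by linarith
    qed
    hence "norm_inf (seq_diff v t) \<le> enat (m + n + d)"
      unfolding norm_inf_seq_diff_le by blast
    moreover have "v \<in> below T (ht t)"
      using vT le by (auto simp: below_def level_def)
    ultimately show ?thesis by (simp add: F_inf_def)
  qed
  moreover have "F_inf T m t \<subseteq> F_inf T (m + n + d) t"
    unfolding F_inf_def using order_trans[of _ "enat m" "enat (m + n + d)"] by auto
  ultimately show ?thesis by blast
qed

lemma G_inf_base_directed:
  assumes T: "linf_tree T" and "V \<in> G_inf_base T" "W \<in> G_inf_base T"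
  shows "\<exists>Y\<in>G_inf_base T. Y \<subseteq> V \<inter> W"
proof -
  have *: "\<exists>Y\<in>G_inf_base T. Y \<subseteq> U_inf T n s \<inter> U_inf T m t"
    if st: "s \<in> T" "t \<in> T" "ht s \<le> ht t" for n m s t
  proof -
    obtain k where "F_inf T n s \<union> F_inf T m t \<subseteq> F_inf T k t"
      using F_inf_directed[OF T st] by blast
    hence "U_inf T k t \<subseteq> U_inf T n s \<inter> U_inf T m t" by (auto simp: U_inf_def)
    thus ?thesis using st by (auto simp: G_inf_base_def)
  qed
  from assms obtain n s m t where "V = U_inf T n s" "s \<in> T" "W = U_inf T m t" "t \<in> T"
    by (auto simp: G_inf_base_def)
  thus ?thesis using *[of s t n m] *[of t s m n] linear[of "ht s" "ht t"] by (auto simp: Int_commute)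
qed

text \<open>The topology is well defined, and \<^const>\<open>G_inf_base\<close> is an open neighbourhood base
  at the identity.\<close>

lemma openin_G_inf_topology:
  assumes T: "linf_tree T"
  shows "openin (G_inf_topology T) W \<longleftrightarrow>
    W \<subseteq> Fpow T \<and> (\<forall>a\<in>W. \<exists>V\<in>G_inf_base T. (\<lambda>b. sym_diff a b) ` V \<subseteq> W)"
proof -
  let ?P = "\<lambda>W. W \<subseteq> carrier (G_inf T) \<and> (\<forall>a\<in>W. \<exists>V\<in>G_inf_base T. a <#\<^bsub>G_inf T\<^esub> V \<subseteq> W)"
  have "istopology ?P"
    unfolding istopology_def
  proof (intro conjI allI impI)
    fix S S' assume S: "?P S" and S': "?P S'"
    show "S \<inter> S' \<subseteq> carrier (G_inf T)" using S by blast
    show "\<forall>a\<in>S \<inter> S'. \<exists>V\<in>G_inf_base T. a <#\<^bsub>G_inf T\<^esub> V \<subseteq> S \<inter> S'"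
    proof
      fix a assume a: "a \<in> S \<inter> S'"
      with S S' obtain V V' where V: "V \<in> G_inf_base T" "a <#\<^bsub>G_inf T\<^esub> V \<subseteq> S"
        "V' \<in> G_inf_base T" "a <#\<^bsub>G_inf T\<^esub> V' \<subseteq> S'" by blast
      then obtain Y where "Y \<in> G_inf_base T" "Y \<subseteq> V \<inter> V'"
        using G_inf_base_directed[OF T] by meson
      moreover from this have "a <#\<^bsub>G_inf T\<^esub> Y \<subseteq> (a <#\<^bsub>G_inf T\<^esub> V) \<inter> (a <#\<^bsub>G_inf T\<^esub> V')"
        unfolding l_coset_def by blast
      ultimately show "\<exists>V\<in>G_inf_base T. a <#\<^bsub>G_inf T\<^esub> V \<subseteq> S \<inter> S'"
        using V by blast
    qed
  next
    fix K assume K: "\<forall>S\<in>K. ?P S"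
    show "\<Union>K \<subseteq> carrier (G_inf T)" using K by blast
    show "\<forall>a\<in>\<Union>K. \<exists>V\<in>G_inf_base T. a <#\<^bsub>G_inf T\<^esub> V \<subseteq> \<Union>K"
    proof
      fix a assume "a \<in> \<Union>K"
      then obtain S V where "S \<in> K" "V \<in> G_inf_base T" "a <#\<^bsub>G_inf T\<^esub> V \<subseteq> S"
        using K by blast
      thus "\<exists>V\<in>G_inf_base T. a <#\<^bsub>G_inf T\<^esub> V \<subseteq> \<Union>K" by blast
    qed
  qed
  hence "openin (G_inf_topology T) W \<longleftrightarrow> ?P W"
    by (simp add: G_inf_topology_def nbhd_base_topology_def)
  moreover have "a <#\<^bsub>G_inf T\<^esub> V = (\<lambda>b. sym_diff a b) ` V" for a V
    by (auto simp: l_coset_def G_inf_def)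
  ultimately show ?thesis by (simp add: G_inf_def)
qed

lemma G_inf_base_nbhd_base:
  assumes T: "linf_tree T"
  shows "V \<in> G_inf_base T \<Longrightarrow> openin (G_inf_topology T) V \<and> {} \<in> V"
    and "openin (G_inf_topology T) W \<Longrightarrow> {} \<in> W \<Longrightarrow> \<exists>V\<in>G_inf_base T. V \<subseteq> W"
proof -
  assume "V \<in> G_inf_base T"
  then obtain n t where V: "V = U_inf T n t" "t \<in> T" by (auto simp: G_inf_base_def)
  have "(\<lambda>b. sym_diff a b) ` V \<subseteq> V" if "a \<in> V" for a
    using that by (auto simp: V U_inf_def Fpow_def)
  moreover have "V \<subseteq> Fpow T" by (auto simp: V U_inf_def)
  ultimately have "openin (G_inf_topology T) V"
    unfolding openin_G_inf_topology[OF T] using \<open>V \<in> G_inf_base T\<close> by blast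
  thus "openin (G_inf_topology T) V \<and> {} \<in> V"
    by (simp add: V U_inf_def Fpow_def)
next
  assume "openin (G_inf_topology T) W" "{} \<in> W"
  then obtain V where "V \<in> G_inf_base T" "(\<lambda>b. sym_diff {} b) ` V \<subseteq> W"
    unfolding openin_G_inf_topology[OF T] by blast
  thus "\<exists>V\<in>G_inf_base T. V \<subseteq> W" by (intro bexI[of _ V]) auto
qed

end

theory Submission
  imports Defs
begin

text \<open>Every \<open>U_inf T n t\<close> is an open subgroup, and two finite sets lie in the same coset of it iff
  they have the same trace on \<open>F_inf T n t\<close>. Since any two nodes of \<open>T\<close> are at finite distance, for
  sets of nodes of height below \<open>\<alpha>\<close> one node \<open>t\<close> of height \<open>\<alpha>\<close> suffices: the countably many sets
  \<open>U_inf T n t\<close> induce the topology on \<open>Fpow (below T \<alpha>)\<close>, which is thus metrized by the largest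
  weight of a point of the symmetric difference, \<open>s\<close> having weight \<open>1 / (1 + \<parallel>s - t\<parallel>)\<close>. By
  regularity of \<open>\<omega>\<^sub>1\<close>, these subgroups exhaust the group, countably many sequences always lie in
  one of them, and no countable family of sets \<open>U_inf T n t\<close> is a neighbourhood base, because the
  heights of the nodes \<open>t\<close> involved are bounded.\<close>

section \<open>Countable sets of countable ordinals\<close>

text \<open>Regularity of \<omega>_1: countably many closed initial segments, each countable, cannot
  cover an uncountable order, and by linearity any point they miss is a strict upper bound.\<close>

lemma countable_omega1_bounded:
  fixes A :: "omega1 set"
  assumes "countable A"
  shows "\<exists>\<beta>. \<forall>\<alpha>\<in>A. \<alpha> < \<beta>"
proof -
  have "{..a} = insert a {..<a}" for a :: omega1 by auto
  hence "countable (\<Union>a\<in>A. {..a})"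
    using assms by (simp add: countable_lessThan_omega1)
  hence "(\<Union>a\<in>A. {..a}) \<noteq> UNIV"
    using uncountable_omega1 by metis
  then obtain \<beta> where "\<beta> \<notin> (\<Union>a\<in>A. {..a})" by blast
  thus ?thesis by (intro exI[of _ \<beta>]) (auto simp: not_le)
qed

section \<open>The maximum-weight ultrametric on finite sets\<close>

text \<open>Inserting 0 gives equal sets distance 0. The \<open>else\<close> value is a default that
  keeps nonnegativity free of side conditions; on \<open>Fpow S\<close> it never occurs.\<close>

definition max_weight_dist :: "('a \<Rightarrow> real) \<Rightarrow> 'a set \<Rightarrow> 'a set \<Rightarrow> real" where
  "max_weight_dist w a b =
     (if finite (sym_diff a b) then Max (insert 0 (w ` sym_diff a b)) else 0)"

lemma max_weight_dist_le_iff: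
  assumes "finite (sym_diff a b)"
  shows "max_weight_dist w a b \<le> r \<longleftrightarrow> 0 \<le> r \<and> (\<forall>s\<in>sym_diff a b. w s \<le> r)"
  using assms by (simp add: max_weight_dist_def)

lemma max_weight_dist_less_iff:
  assumes "finite (sym_diff a b)"
  shows "max_weight_dist w a b < r \<longleftrightarrow> 0 < r \<and> (\<forall>s\<in>sym_diff a b. w s < r)"
  using assms by (simp add: max_weight_dist_def)

lemma max_weight_dist_nonneg: "0 \<le> max_weight_dist w a b"
  by (simp add: max_weight_dist_def)

text \<open>Positive weights separate points. Since \<open>sym_diff a c\<close> lies in the union of
  the other two differences, even the ultrametric inequality holds.\<close>

lemma Metric_space_max_weight_dist:
  assumes w: "\<And>s. s \<in> S \<Longrightarrow> 0 < w s"
  shows "Metric_space (Fpow S) (max_weight_dist w)"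
proof
  fix a b c :: "'a set"
  show "0 \<le> max_weight_dist w a b" by (rule max_weight_dist_nonneg)
  show "max_weight_dist w a b = max_weight_dist w b a"
    by (simp add: max_weight_dist_def Un_commute conj_commute)
  assume a: "a \<in> Fpow S" and b: "b \<in> Fpow S"
  hence ab: "finite (sym_diff a b)" and sub: "sym_diff a b \<subseteq> S" by (auto simp: Fpow_def)
  have "max_weight_dist w a b \<le> 0 \<longleftrightarrow> sym_diff a b = {}"
    using w sub by (force simp: max_weight_dist_le_iff[OF ab] not_le[symmetric])
  thus "max_weight_dist w a b = 0 \<longleftrightarrow> a = b"
    using max_weight_dist_nonneg[of w a b] by auto
  assume "c \<in> Fpow S"
  hence bc: "finite (sym_diff b c)" and ac: "finite (sym_diff a c)"
    using a b by (auto simp: Fpow_def)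
  let ?r = "max (max_weight_dist w a b) (max_weight_dist w b c)"
  have "max_weight_dist w a b \<le> ?r" "max_weight_dist w b c \<le> ?r" by simp_all
  hence "w s \<le> ?r" if "s \<in> sym_diff a b \<union> sym_diff b c" for s
    using that unfolding max_weight_dist_le_iff[OF ab] max_weight_dist_le_iff[OF bc] by blast
  moreover have "sym_diff a c \<subseteq> sym_diff a b \<union> sym_diff b c" by blast
  ultimately have "max_weight_dist w a c \<le> ?r"
    unfolding max_weight_dist_le_iff[OF ac]
    using max_weight_dist_nonneg[of w a b] by (meson le_max_iff_disj subsetD)
  thus "max_weight_dist w a c \<le> max_weight_dist w a b + max_weight_dist w b c"
    using max_weight_dist_nonneg[of w a b] max_weight_dist_nonneg[of w b c] by linarith
qed

section \<open>The group topology\<close>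

lemma G_inf_simps [simp]:
  "carrier (G_inf T) = Fpow T" "a \<otimes>\<^bsub>G_inf T\<^esub> b = sym_diff a b" "\<one>\<^bsub>G_inf T\<^esub> = {}"
  by (simp_all add: G_inf_def)

lemma group_G_inf: "group (G_inf T)"
proof (rule groupI)
  fix x assume "x \<in> carrier (G_inf T)"
  thus "\<exists>y\<in>carrier (G_inf T). y \<otimes>\<^bsub>G_inf T\<^esub> x = \<one>\<^bsub>G_inf T\<^esub>"
    by (intro bexI[of _ x]) auto
qed (auto simp: Fpow_def)

lemma inv_G_inf: "a \<in> Fpow T \<Longrightarrow> inv\<^bsub>G_inf T\<^esub> a = a"
  by (rule group.inv_equality[OF group_G_inf]) simp_all

lemma subgroup_Fpow_below: "subgroup (Fpow (below T \<alpha>)) (G_inf T)"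
proof -
  have "below T \<alpha> \<subseteq> T" by (auto simp: below_def level_def)
  hence sub: "Fpow (below T \<alpha>) \<subseteq> Fpow T" by (rule Fpow_mono)
  thus ?thesis
    by (unfold_locales) (auto simp: inv_G_inf subset_iff Fpow_def)
qed

text \<open>Stated through traces rather than translates, so that later arguments are plain set
  algebra.\<close>

definition F_coset :: "seq set \<Rightarrow> seq set \<Rightarrow> nat \<Rightarrow> seq \<Rightarrow> seq set set" where
  "F_coset T a n t = {b \<in> Fpow T. b \<inter> F_inf T n t = a \<inter> F_inf T n t}"

lemma F_coset_eq_image_U_inf:
  assumes "a \<in> Fpow T"
  shows "(\<lambda>b. sym_diff a b) ` U_inf T n t = F_coset T a n t"
proof
  show "(\<lambda>b. sym_diff a b) ` U_inf T n t \<subseteq> F_coset T a n t"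
    using assms by (auto simp: U_inf_def F_coset_def Fpow_def)
  show "F_coset T a n t \<subseteq> (\<lambda>b. sym_diff a b) ` U_inf T n t"
  proof
    fix b assume "b \<in> F_coset T a n t"
    hence "sym_diff a b \<in> U_inf T n t"
      using assms by (auto simp: U_inf_def F_coset_def Fpow_def)
    \<comment> \<open>Translation by \<open>a\<close> is an involution, which supplies the preimage
      of \<open>b\<close>.\<close>
    moreover have "b = sym_diff a (sym_diff a b)" by blast
    ultimately show "b \<in> (\<lambda>b. sym_diff a b) ` U_inf T n t" by (rule rev_image_eqI)
  qed
qed

lemma openin_G_inf_topology_iff:
  assumes "linf_tree T"
  shows "openin (G_inf_topology T) W \<longleftrightarrow>
    W \<subseteq> Fpow T \<and> (\<forall>a\<in>W. \<exists>n. \<exists>t\<in>T. F_coset T a n t \<subseteq> W)"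
proof -
  have "(\<exists>V\<in>G_inf_base T. (\<lambda>b. sym_diff a b) ` V \<subseteq> W) \<longleftrightarrow> (\<exists>n. \<exists>t\<in>T. F_coset T a n t \<subseteq> W)"
    if "a \<in> Fpow T" for a
    using F_coset_eq_image_U_inf[OF that] by (fastforce simp: G_inf_base_def)
  thus ?thesis unfolding openin_G_inf_topology[OF assms]
    by (intro conj_cong ball_cong refl) (meson subsetD)
qed

text \<open>Cosets partition the group: the coset of any of its members is the coset itself, so the
  same \<open>n\<close> and \<open>t\<close> serve at every point.\<close>

lemma openin_F_coset:
  assumes "linf_tree T" "t \<in> T"
  shows "openin (G_inf_topology T) (F_coset T a n t)"
proof -
  have "F_coset T b n t = F_coset T a n t" if "b \<in> F_coset T a n t" for b
    using that by (auto simp: F_coset_def)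
  thus ?thesis
    unfolding openin_G_inf_topology_iff[OF assms(1)] using assms(2)
    by (auto simp: F_coset_def)
qed

lemma omega1_tree_level_nonempty:
  assumes "linf_tree T"
  obtains t where "t \<in> T" "ht t = \<alpha>"
proof -
  have "level T \<alpha> \<noteq> {}" using assms by (simp add: linf_tree_def omega1_tree_def)
  thus ?thesis using that by (auto simp: level_def)
qed

lemma topspace_G_inf:
  assumes "linf_tree T"
  shows "topspace (G_inf_topology T) = Fpow T"
proof -
  obtain t where "t \<in> T" using omega1_tree_level_nonempty[OF assms] by metis
  hence "openin (G_inf_topology T) (Fpow T)"
    unfolding openin_G_inf_topology_iff[OF assms] by (auto simp: F_coset_def)
  moreover have "topspace (G_inf_topology T) \<subseteq> Fpow T"
    using openin_G_inf_topology_iff[OF assms] openin_topspace by blast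
  ultimately show ?thesis using openin_subset by blast
qed

lemma topological_group_G_inf:
  assumes T: "linf_tree T"
  shows "topological_group (G_inf T) (G_inf_topology T)"
proof -
  let ?X = "G_inf_topology T"
  note ts = topspace_G_inf[OF T]
  have "continuous_map (prod_topology ?X ?X) ?X (\<lambda>(x, y). sym_diff x y)"
    unfolding continuous_map
  proof (intro conjI allI impI)
    show "(\<lambda>(x, y). sym_diff x y) ` topspace (prod_topology ?X ?X) \<subseteq> topspace ?X"
      by (auto simp: ts Fpow_def)
    fix W assume W: "openin ?X W"
    let ?P = "{p \<in> topspace (prod_topology ?X ?X). (case p of (x, y) \<Rightarrow> sym_diff x y) \<in> W}"
    show "openin (prod_topology ?X ?X) ?P"
      unfolding openin_prod_topology_alt
    proof (intro allI impI)
      fix x y assume "(x, y) \<in> ?P"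
      hence xy: "x \<in> Fpow T" "y \<in> Fpow T" "sym_diff x y \<in> W" by (auto simp: ts)
      then obtain n t where t: "t \<in> T" "F_coset T (sym_diff x y) n t \<subseteq> W"
        using W unfolding openin_G_inf_topology_iff[OF T] by meson
      let ?F = "F_inf T n t"
      have "(x', y') \<in> ?P" if "x' \<in> F_coset T x n t" "y' \<in> F_coset T y n t" for x' y'
      proof -
        have "x' \<inter> ?F = x \<inter> ?F" "y' \<inter> ?F = y \<inter> ?F"
          using that by (auto simp: F_coset_def)
        \<comment> \<open>Taking traces commutes with symmetric difference, so one pair
          \<open>n\<close>, \<open>t\<close> works for both factors.\<close>
        hence "sym_diff x' y' \<inter> ?F = sym_diff x y \<inter> ?F" by blast
        moreover have x'y': "x' \<in> Fpow T" "y' \<in> Fpow T" using that by (auto simp: F_coset_def)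
        moreover from x'y' have "sym_diff x' y' \<in> Fpow T" by (auto simp: Fpow_def)
        ultimately have "sym_diff x' y' \<in> F_coset T (sym_diff x y) n t"
          unfolding F_coset_def by blast
        thus ?thesis using t(2) x'y' by (auto simp: ts)
      qed
      thus "\<exists>U V. openin ?X U \<and> openin ?X V \<and> x \<in> U \<and> y \<in> V \<and> U \<times> V \<subseteq> ?P"
        using xy openin_F_coset[OF T t(1)]
        by (intro exI[of _ "F_coset T x n t"] exI[of _ "F_coset T y n t"]) (auto simp: F_coset_def)
    qed
  qed
  moreover have "continuous_map ?X ?X (\<lambda>x. inv\<^bsub>G_inf T\<^esub> x)"
    by (rule continuous_map_eq[OF continuous_map_id]) (simp add: ts inv_G_inf)
  ultimately show ?thesis
    by (simp add: topological_group_def group_G_inf ts)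
qed

section \<open>Metrizability of bounded pieces\<close>

text \<open>The triangle inequality with \<open>d\<close> the distance from \<open>s\<close> to
  \<open>t\<close>. The heights of \<open>s\<close> and \<open>t\<close> need not be compared: a
  node \<open>v\<close> in the intersection is lower than both, so its domain lies in both of
  theirs.\<close>

lemma F_inf_below_subset:
  assumes T: "linf_tree T" and s: "s \<in> T" and t: "t \<in> T"
  obtains k where "F_inf T n s \<inter> below T (ht t) \<subseteq> F_inf T k t"
proof -
  from T s t have "norm_inf (seq_diff s t) < \<infinity>" by (simp add: linf_tree_def)
  then obtain d where "norm_inf (seq_diff s t) = enat d" by auto
  hence d: "\<bar>int (the (s \<gamma>)) - int (the (t \<gamma>))\<bar> \<le> int d" if "\<gamma> \<in> dom s \<inter> dom t" for \<gamma>
    using norm_inf_seq_diff_le[of s t d] that by simp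
  have dm: "dom v = {..<ht v}" if "v \<in> T" for v
    using dom_eq_lessThan_ht[of v] that T
    by (auto simp: linf_tree_def omega1_tree_def seq_tree_def)
  have "v \<in> F_inf T (n + d) t" if v: "v \<in> F_inf T n s" "v \<in> below T (ht t)" for v
  proof -
    from v have vT: "v \<in> T" "ht v < ht s" "ht v < ht t"
      and vn: "\<forall>\<gamma>\<in>dom v \<inter> dom s. \<bar>int (the (v \<gamma>)) - int (the (s \<gamma>))\<bar> \<le> int n"
      by (auto simp: F_inf_def below_def level_def norm_inf_seq_diff_le)
    have "\<bar>int (the (v \<gamma>)) - int (the (t \<gamma>))\<bar> \<le> int (n + d)" if "\<gamma> \<in> dom v \<inter> dom t" for \<gamma>
    proof -
      have "\<gamma> \<in> dom v \<inter> dom s" "\<gamma> \<in> dom s \<inter> dom t"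
        using that vT unfolding dm[OF vT(1)] dm[OF s] dm[OF t] by auto
      thus ?thesis using bspec[OF vn] d by fastforce
    qed
    thus ?thesis using v(2) by (simp add: F_inf_def norm_inf_seq_diff_le)
  qed
  thus ?thesis by (intro that[of "n + d"]) blast
qed

text \<open>Sets of nodes below \<open>ht t\<close> meet \<open>F_inf T n s\<close> only in its part
  below \<open>ht t\<close>, and some \<open>F_inf T k t\<close> covers that part.\<close>

lemma F_coset_Fpow_below:
  assumes "linf_tree T" "s \<in> T" "t \<in> T" "a \<in> Fpow (below T (ht t))"
  obtains k where "F_coset T a k t \<inter> Fpow (below T (ht t)) \<subseteq> F_coset T a n s"
proof -
  obtain k where k: "F_inf T n s \<inter> below T (ht t) \<subseteq> F_inf T k t"
    using F_inf_below_subset[OF assms(1-3)] by blast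
  have "b \<in> F_coset T a n s" if "b \<in> F_coset T a k t" "b \<in> Fpow (below T (ht t))" for b
  proof -
    have "b \<inter> F_inf T k t = a \<inter> F_inf T k t" and "b \<in> Fpow T"
      using that by (auto simp: F_coset_def)
    moreover have "a \<subseteq> below T (ht t)" "b \<subseteq> below T (ht t)"
      using that assms(4) by (auto simp: Fpow_def)
    ultimately show ?thesis using k unfolding F_coset_def by blast
  qed
  thus ?thesis by (intro that[of k]) blast
qed

lemma openin_subtopology_Fpow_below:
  assumes T: "linf_tree T" and t: "t \<in> T"
  defines "H \<equiv> Fpow (below T (ht t))"
  shows "openin (subtopology (G_inf_topology T) H) U \<longleftrightarrow>
    U \<subseteq> H \<and> (\<forall>a\<in>U. \<exists>k. F_coset T a k t \<inter> H \<subseteq> U)"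
proof
  assume "openin (subtopology (G_inf_topology T) H) U"
  then obtain W where W: "openin (G_inf_topology T) W" "U = W \<inter> H"
    by (auto simp: openin_subtopology)
  have "\<exists>k. F_coset T a k t \<inter> H \<subseteq> U" if a: "a \<in> U" for a
  proof -
    from a W obtain n s where s: "s \<in> T" "F_coset T a n s \<subseteq> W"
      unfolding openin_G_inf_topology_iff[OF T] by blast
    obtain k where "F_coset T a k t \<inter> H \<subseteq> F_coset T a n s"
      using F_coset_Fpow_below[OF T s(1) t] a W(2) unfolding H_def by blast
    thus ?thesis using s(2) W(2) by blast
  qed
  thus "U \<subseteq> H \<and> (\<forall>a\<in>U. \<exists>k. F_coset T a k t \<inter> H \<subseteq> U)" using W(2) by blast
next
  assume U: "U \<subseteq> H \<and> (\<forall>a\<in>U. \<exists>k. F_coset T a k t \<inter> H \<subseteq> U)"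
  \<comment> \<open>The union of all cosets at \<open>t\<close> whose trace on \<open>H\<close>
    stays inside \<open>U\<close>; each point of \<open>U\<close> lies in one of them.\<close>
  let ?W = "\<Union>{F_coset T a k t | a k. F_coset T a k t \<inter> H \<subseteq> U}"
  have "H \<subseteq> Fpow T" unfolding H_def by (rule Fpow_mono) (auto simp: below_def level_def)
  hence "a \<in> F_coset T a k t" if "a \<in> U" for a k
    using that U by (auto simp: F_coset_def)
  hence "U = ?W \<inter> H" using U by blast
  moreover have "openin (G_inf_topology T) ?W"
    by (rule openin_Union) (auto intro: openin_F_coset[OF T t])
  ultimately show "openin (subtopology (G_inf_topology T) H) U"
    by (auto simp: openin_subtopology)
qed

lemma metrizable_Fpow_below:
  assumes T: "linf_tree T"
  shows "metrizable_space (subtopology (G_inf_topology T) (Fpow (below T \<alpha>)))"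
proof -
  obtain t where t: "t \<in> T" "ht t = \<alpha>" using omega1_tree_level_nonempty[OF T] by metis
  define H where "H = Fpow (below T (ht t))"
  \<comment> \<open>All distances in an l_\<infinity>-tree are finite, so \<open>the_enat\<close>
    loses nothing on nodes of \<open>T\<close>.\<close>
  define r where "r s = the_enat (norm_inf (seq_diff s t))" for s
  define w where "w s = 1 / (1 + real (r s))" for s
  interpret Metric_space H "max_weight_dist w"
    unfolding H_def by (rule Metric_space_max_weight_dist) (simp add: w_def)
  have below: "below T (ht t) \<subseteq> T" by (auto simp: below_def level_def)
  have F: "s \<in> F_inf T k t \<longleftrightarrow> r s \<le> k" if s: "s \<in> below T (ht t)" for s k
  proof -
    have "norm_inf (seq_diff s t) < \<infinity>" using T t s below by (auto simp: linf_tree_def)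
    thus ?thesis using s by (auto simp: F_inf_def r_def)
  qed
  \<comment> \<open>Nodes close to \<open>t\<close> weigh more: all differing nodes weigh less than
    1/(1+k) exactly when all lie farther than \<open>k\<close> from \<open>t\<close>, that is,
    outside \<open>F_inf T k t\<close>.\<close>
  have ball: "mball a (1 / (1 + real k)) = F_coset T a k t \<inter> H" if a: "a \<in> H" for a k
  proof -
    have "max_weight_dist w a b < 1 / (1 + real k) \<longleftrightarrow> b \<in> F_coset T a k t" if b: "b \<in> H" for b
    proof -
      have fin: "finite (sym_diff a b)" and sub: "a \<subseteq> below T (ht t)" "b \<subseteq> below T (ht t)"
        and bT: "b \<in> Fpow T"
        using a b below by (auto simp: H_def Fpow_def)
      have "max_weight_dist w a b < 1 / (1 + real k) \<longleftrightarrow> (\<forall>s\<in>sym_diff a b. k < r s)"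
        unfolding max_weight_dist_less_iff[OF fin] by (auto simp: w_def field_simps)
      also have "\<dots> \<longleftrightarrow> (\<forall>s\<in>sym_diff a b. s \<notin> F_inf T k t)"
        using sub by (intro ball_cong refl) (auto simp: F subset_iff)
      also have "\<dots> \<longleftrightarrow> b \<in> F_coset T a k t"
        using bT by (auto simp: F_coset_def)
      finally show ?thesis .
    qed
    thus ?thesis using a by (auto simp: mball_def)
  qed
  have "openin mtopology U \<longleftrightarrow> openin (subtopology (G_inf_topology T) H) U" for U
  proof -
    have "(\<exists>e>0. mball a e \<subseteq> U) \<longleftrightarrow> (\<exists>k. F_coset T a k t \<inter> H \<subseteq> U)" if a: "a \<in> H" for a
    proof
      assume "\<exists>e>0. mball a e \<subseteq> U"
      then obtain e where e: "e > 0" "mball a e \<subseteq> U" by blast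
      then obtain k where "1 / (1 + real k) < e"
        using nat_approx_posE[of e] by (metis of_nat_Suc)
      hence "mball a (1 / (1 + real k)) \<subseteq> U" using e(2) mball_subset_concentric by fastforce
      thus "\<exists>k. F_coset T a k t \<inter> H \<subseteq> U" using ball[OF a] by blast
    next
      assume "\<exists>k. F_coset T a k t \<inter> H \<subseteq> U"
      then obtain k where "mball a (1 / (1 + real k)) \<subseteq> U" using ball[OF a] by blast
      thus "\<exists>e>0. mball a e \<subseteq> U" by (intro exI[of _ "1 / (1 + real k)"]) simp
    qed
    thus ?thesis
      unfolding openin_mtopology openin_subtopology_Fpow_below[OF T t(1), folded H_def] by blast
  qed
  hence "mtopology = subtopology (G_inf_topology T) H" by (simp add: topology_eq)
  thus ?thesis using metrizable_space_mtopology t(2) by (simp add: H_def)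
qed

section \<open>Countable families of nodes\<close>

lemma countable_subset_below:
  assumes "S \<subseteq> T" "countable S"
  obtains \<alpha> where "S \<subseteq> below T \<alpha>"
proof -
  obtain \<alpha> where "\<forall>\<beta>\<in>ht ` S. \<beta> < \<alpha>"
    using countable_omega1_bounded[OF countable_image[OF assms(2)]] by blast
  hence "S \<subseteq> below T \<alpha>" using assms(1) by (auto simp: below_def level_def)
  thus ?thesis by (rule that)
qed

text \<open>First countability fails at the identity. For a countable base, the nodes chosen for its
  members have heights below some \<alpha>. A singleton of a node of height \<alpha> then lies in
  every member of the base, but not in the neighbourhood given by a higher extension of that
  node.\<close>

lemma not_metrizable_G_inf:
  assumes T: "linf_tree T"
  shows "\<not> metrizable_space (G_inf_topology T)"
proof
  let ?X = "G_inf_topology T"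
  assume "metrizable_space ?X"
  hence "first_countable ?X" by (rule metrizable_imp_first_countable)
  moreover have "{} \<in> topspace ?X" by (simp add: topspace_G_inf[OF T] Fpow_def)
  ultimately obtain B where B: "countable B" "\<And>V. V \<in> B \<Longrightarrow> openin ?X V"
    "\<And>U. openin ?X U \<Longrightarrow> {} \<in> U \<Longrightarrow> \<exists>V\<in>B. {} \<in> V \<and> V \<subseteq> U"
    unfolding first_countable_def by metis
  have "\<forall>V. V \<in> B \<and> {} \<in> V \<longrightarrow> (\<exists>t. t \<in> T \<and> (\<exists>n. F_coset T {} n t \<subseteq> V))"
    using B(2) unfolding openin_G_inf_topology_iff[OF T] by blast
  then obtain \<tau> where \<tau>: "\<And>V. V \<in> B \<Longrightarrow> {} \<in> V \<Longrightarrow> \<tau> V \<in> T \<and> (\<exists>n. F_coset T {} n (\<tau> V) \<subseteq> V)"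
    by metis
  \<comment> \<open>The bound also covers the arbitrary values of \<open>\<tau>\<close> at members
    of \<open>B\<close> missing the identity, which is harmless.\<close>
  obtain \<alpha> where \<alpha>: "\<forall>\<gamma>\<in>(\<lambda>V. ht (\<tau> V)) ` B. \<gamma> < \<alpha>"
    using countable_omega1_bounded[OF countable_image[OF B(1)]] by blast
  obtain \<beta> where \<beta>: "\<alpha> < \<beta>" using countable_omega1_bounded[of "{\<alpha>}"] by auto
  obtain t where t: "t \<in> T" "ht t = \<beta>" using omega1_tree_level_nonempty[OF T] by metis
  \<comment> \<open>A proper restriction of \<open>t\<close> is at distance 0 from \<open>t\<close>
    and strictly lower, hence in \<open>F_inf T 0 t\<close>.\<close>
  define s where "s = t |` {..<\<alpha>}"
  have "dom t = {..<\<beta>}"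
    using T t dom_eq_lessThan_ht by (auto simp: linf_tree_def omega1_tree_def seq_tree_def)
  hence "dom s = {..<\<alpha>}" using \<beta> by (auto simp: s_def)
  hence hts: "ht s = \<alpha>" by (rule ht_eqI)
  have sT: "s \<in> T"
    using T t by (auto simp: s_def linf_tree_def omega1_tree_def seq_tree_def)
  have "norm_inf (seq_diff s t) \<le> enat 0"
    unfolding norm_inf_seq_diff_le by (auto simp: s_def restrict_map_def split: if_splits)
  hence s0: "s \<in> F_inf T 0 t" using sT hts \<beta> t by (auto simp: F_inf_def below_def level_def)
  have "{} \<in> F_coset T {} 0 t" by (simp add: F_coset_def Fpow_def)
  then obtain V where V: "V \<in> B" "{} \<in> V" "V \<subseteq> F_coset T {} 0 t"
    using B(3)[OF openin_F_coset[OF T t(1)]] by blast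
  obtain n where n: "F_coset T {} n (\<tau> V) \<subseteq> V" using \<tau> V by blast
  \<comment> \<open>For every \<open>n\<close>, this set contains only nodes lower than
    \<open>\<tau> V\<close>, hence of height below \<alpha>.\<close>
  have "s \<notin> F_inf T n (\<tau> V)"
    using \<alpha> V(1) hts by (auto simp: F_inf_def below_def level_def)
  hence "{s} \<in> F_coset T {} n (\<tau> V)" using sT by (auto simp: F_coset_def Fpow_def)
  hence "{s} \<in> F_coset T {} 0 t" using n V(3) by blast
  thus False using s0 by (simp add: F_coset_def)
qed

text \<open>All terms lie in one subgroup \<open>H\<close> where the decreasing sets
  \<open>V k\<close> trace a countable base at the identity. There the diagonal argument for first
  countable spaces applies: keep from the \<open>n\<close>-th sequence only a tail inside
  \<open>V n\<close>, and merge the tails.\<close>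

lemma alpha1_group_G_inf:
  assumes T: "linf_tree T"
  shows "alpha1_group (G_inf T) (G_inf_topology T)"
proof -
  let ?X = "G_inf_topology T"
  have "\<exists>s' :: nat \<Rightarrow> seq set. range s' \<subseteq> Fpow T \<and> limitin ?X s' {} sequentially \<and>
          (\<forall>n. finite (range (s n) - range s'))"
    if s: "\<forall>n. range (s n) \<subseteq> Fpow T \<and> limitin ?X (s n) {} sequentially" for s :: "nat \<Rightarrow> nat \<Rightarrow> seq set"
  proof -
    have sT: "s n j \<in> Fpow T" for n j using s by blast
    have "countable (\<Union>n. \<Union>j. s n j)"
      using sT by (auto simp: Fpow_def countable_finite)
    moreover have "(\<Union>n. \<Union>j. s n j) \<subseteq> T" using sT by (auto simp: Fpow_def)
    ultimately obtain \<alpha> where "(\<Union>n. \<Union>j. s n j) \<subseteq> below T \<alpha>"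
      using countable_subset_below by metis
    moreover obtain t where t: "t \<in> T" "ht t = \<alpha>" using omega1_tree_level_nonempty[OF T] by metis
    moreover define H where "H = Fpow (below T (ht t))"
    ultimately have sH: "s n j \<in> H" for n j using sT by (fastforce simp: Fpow_def)
    define V where "V k = F_coset T {} k t" for k
    have V_mono: "V n \<subseteq> V k" if "k \<le> n" for k n
    proof -
      have "F_inf T k t \<subseteq> F_inf T n t"
        using that by (auto simp: F_inf_def intro: order_trans[of _ "enat k" "enat n"])
      thus ?thesis by (auto simp: V_def F_coset_def)
    qed
    have empty_V: "{} \<in> V k" for k by (simp add: V_def F_coset_def Fpow_def)
    have "\<exists>J. \<forall>j\<ge>J. s n j \<in> V k" for n k
      using s openin_F_coset[OF T t(1)] empty_V[of k]
      unfolding limitin_sequentially V_def by blast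
    then obtain J where J: "\<And>n k j. J n k \<le> j \<Longrightarrow> s n j \<in> V k" by metis
    \<comment> \<open>Pairs are enumerated by \<open>prod_decode\<close>. Discarded terms become the
      identity, which lies in every \<open>V k\<close>, so convergence is not disturbed.\<close>
    define s' where "s' = (\<lambda>(n, j). if J n n \<le> j then s n j else {}) \<circ> prod_decode"
    have s': "s' (prod_encode (n, j)) = (if J n n \<le> j then s n j else {})" for n j
      by (simp add: s'_def)
    have s'H: "s' i \<in> H" for i
      using sH by (auto simp: s'_def H_def Fpow_def split: prod.split)
    have H: "H \<subseteq> Fpow T" unfolding H_def by (rule Fpow_mono) (auto simp: below_def level_def)
    have ev: "\<exists>N. \<forall>i\<ge>N. s' i \<in> V k" for k
    proof -
      \<comment> \<open>Rows \<open>n \<ge> k\<close> stay in \<open>V n\<close>, hence in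
        \<open>V k\<close>; each of the finitely many rows \<open>n < k\<close> has only finitely
        many terms outside \<open>V k\<close>.\<close>
      have "s' (prod_encode (n, j)) \<in> V k" if "(n, j) \<notin> (SIGMA n:{..<k}. {..<J n k})" for n j
      proof (cases "n < k")
        case True
        thus ?thesis using that J[of n k j] empty_V by (auto simp: s')
      next
        case False
        thus ?thesis using J[of n n j] V_mono[of k n] empty_V by (auto simp: s')
      qed
      hence "{i. s' i \<notin> V k} \<subseteq> prod_encode ` (SIGMA n:{..<k}. {..<J n k})"
        by (smt (verit, best) image_iff mem_Collect_eq prod_decode_inverse subsetI surj_pair)
      hence "finite {i. s' i \<notin> V k}" by (rule finite_subset) auto
      then obtain N where "\<forall>i\<in>{i. s' i \<notin> V k}. i < N"
        using finite_nat_set_iff_bounded by blast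
      thus ?thesis by (intro exI[of _ N]) (use not_le in blast)
    qed
    have "limitin ?X s' {} sequentially"
      unfolding limitin_sequentially
    proof (intro conjI allI impI)
      show "{} \<in> topspace ?X" by (simp add: topspace_G_inf[OF T] Fpow_def)
      fix W assume W: "openin ?X W \<and> {} \<in> W"
      then obtain n u where u: "u \<in> T" "F_coset T {} n u \<subseteq> W"
        unfolding openin_G_inf_topology_iff[OF T] by blast
      have "{} \<in> Fpow (below T (ht t))" by (simp add: Fpow_def)
      then obtain k where "V k \<inter> H \<subseteq> F_coset T {} n u"
        using F_coset_Fpow_below[OF T u(1) t(1)] unfolding V_def H_def by blast
      thus "\<exists>N. \<forall>i\<ge>N. s' i \<in> W" using ev[of k] s'H u(2) by blast
    qed
    moreover have "finite (range (s n) - range s')" for n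
    proof -
      have "s n j \<in> range s'" if "J n n \<le> j" for j
        using s'[of n j] that by (metis rangeI)
      \<comment> \<open>Only terms cut off before the tail of row \<open>n\<close> can be
        missing.\<close>
      hence "range (s n) - range s' \<subseteq> s n ` {..<J n n}"
        using not_le by blast
      thus ?thesis by (rule finite_subset) simp
    qed
    ultimately show ?thesis using s'H H by blast
  qed
  thus ?thesis by (simp add: alpha1_group_def topological_group_G_inf[OF T])
qed

theorem corollary6p9:
  fixes T :: "seq set"
  assumes "linf_tree T"
    and "normal_tree T"
    and "omega_splitting T"
  shows "topological_group (G_inf T) (G_inf_topology T)
    \<and> \<not> metrizable_space (G_inf_topology T)
    \<and> (\<exists>C. chain\<^sub>\<subseteq> C
          \<and> (\<forall>H\<in>C. subgroup H (G_inf T) \<and> metrizable_space (subtopology (G_inf_topology T) H))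
          \<and> \<Union>C = carrier (G_inf T))
    \<and> alpha1_group (G_inf T) (G_inf_topology T)"
proof (intro conjI)
  let ?C = "range (\<lambda>\<alpha>. Fpow (below T \<alpha>))"
  have "Fpow (below T \<alpha>) \<subseteq> Fpow (below T \<beta>)" if "\<alpha> \<le> \<beta>" for \<alpha> \<beta>
    using that by (intro Fpow_mono) (auto simp: below_def intro: less_le_trans)
  hence "Fpow (below T \<alpha>) \<subseteq> Fpow (below T \<beta>) \<or> Fpow (below T \<beta>) \<subseteq> Fpow (below T \<alpha>)" for \<alpha> \<beta>
    using linear[of \<alpha> \<beta>] by blast
  hence "chain\<^sub>\<subseteq> ?C" unfolding chain_subset_def by blast
  moreover have "\<Union>?C = Fpow T"
  proof
    show "\<Union>?C \<subseteq> Fpow T" by (auto simp: Fpow_def below_def level_def)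
    show "Fpow T \<subseteq> \<Union>?C"
    proof
      fix a assume "a \<in> Fpow T"
      hence "a \<subseteq> T" "finite a" by (auto simp: Fpow_def)
      \<comment> \<open>A finite set of nodes has bounded heights, so it already belongs to one
        member of the chain.\<close>
      then obtain \<alpha> where "a \<subseteq> below T \<alpha>" using countable_subset_below[OF _ countable_finite] by blast
      thus "a \<in> \<Union>?C" using \<open>finite a\<close> by (auto simp: Fpow_def)
    qed
  qed
  ultimately show "\<exists>C. chain\<^sub>\<subseteq> C
          \<and> (\<forall>H\<in>C. subgroup H (G_inf T) \<and> metrizable_space (subtopology (G_inf_topology T) H))
          \<and> \<Union>C = carrier (G_inf T)"
    by (intro exI[of _ ?C]) (auto simp: subgroup_Fpow_below metrizable_Fpow_below[OF assms(1)])
qed (use assms(1) in \<open>auto simp: topological_group_G_inf not_metrizable_G_inf alpha1_group_G_inf\<close>)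

end
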